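(* Let $\mathcal P$ be a pure $2$-dimensional simplicial poset and let $G\subseteq\mathcal P^{(1)}$ be a bypassing subgraph in $\mathcal P$ which is $1$-ic-colorable in $\mathcal P$. Then the graph metric $d_G$ on $\mathcal P$ is extreme.
   Context: A simplicial poset is a poset with unique minimum $\hat0$ in which every interval $[\hat0,x]$ is isomorphic to a Boolean lattice; elements whose lower interval is the Boolean lattice on $1,2,3$ elements are vertices, edges, triangles; each edge has two distinct endpoints, each triangle three edge facets. Pure $2$-dimensional: every maximal element is a triangle. $\mathcal P^{(1)}$ is the graph with vertices and edges those of $\mathcal P$ (multiple edges allowed). A metric on $\mathcal P$ is a function $d:\mathcal P(1)\to\mathbb R_{\ge0}$ such that for every triangle with facets $e_1,e_2,e_3$: $d(e_1)+d(e_2)\ge d(e_3)$, $d(e_2)+d(e_3)\ge d(e_1)$, $d(e_1)+d(e_3)\ge d(e_2)$. A nonzero metric $d$ is extreme if whenever $d=d'+d''$ with $d',d''$ metrics on $\mathcal P$, one has $d'=\lambda d$ for some $\lambda\ge0$ (i.e. $d$ spans an extreme ray of the cone of metrics). A walk is a sequence of edges $e_1,\dots,e_m$ with vertices $v_1,\dots,v_{m+1}$, $e_i$ having endpoints $v_i,v_{i+1}$; its length is $m$. A cycle is a walk with no repeated edge whose first and last vertices coincide. An elementary contraction replaces two consecutive edges $e_i,e_{i+1}$ of a walk by an edge $\tilde e$ such that $e_i,e_{i+1},\tilde e$ are the three facets of a triangle; a walk can be contracted to $q$ if $q$ results from finitely many (possibly zero) elementary contractions. $G$ is bypassing in $\mathcal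 P$ if it contains all vertices and each edge $e$ of $\mathcal P$ admits a walk in $G$ contractable to the one-edge walk $e$. $B_G(e)$ is the set of shortest walks in $G$ contractable to $e$, and $d_G(e)$ is their common length; $d_G$ is a metric on $\mathcal P$ (the graph metric induced by $G$). An isometric even cycle in $G$ with respect to $\mathcal P$ is a cycle in $G$ with edges $e_1,\dots,e_{2n}$ and vertices $v_1,\dots,v_{2n}$ ($e_i$ joining $v_i,v_{i+1}$, indices mod $2n$) such that for each $1\le i\le n$ there is an edge $\tilde e_i\in\mathcal P(1)\setminus E(G)$ joining $v_i$ and $v_{i+n}$ for which both walks $e_i,\dots,e_{i+n-1}$ and $e_{i+n},\dots,e_{i+2n-1}$ (indices mod $2n$) lie in $B_G(\tilde e_i)$; in it, the edges $e_i$ and $e_{i+n}$ are called opposite. Let $\sim$ be the smallest equivalence relation on $E(G)$ such that $e\sim e'$ whenever $e,e'$ are opposite edges of some isometric even cycle in $G$ with respect to $\mathcal P$ (its classes are the color classes of the isometric cycle coloring). $G$ is $k$-ic-colorable in $\mathcal P$ if $\sim$ has exactly $k$ equivalence classes. *)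

theory Defs
  imports Complex_Main
begin

record 'a graph =
  gverts :: "'a set"
  gedges :: "'a set"

text \<open>The pair (vertices visited, edges traversed).\<close>

type_synonym 'a walk = "'a list \<times> 'a list"

definition walk_length :: "'a walk \<Rightarrow> nat" where
  "walk_length w = length (snd w)"

context
  fixes P :: "'a set" and r :: "'a rel"
begin

definition is_minimum :: "'a \<Rightarrow> bool" where
  "is_minimum b \<longleftrightarrow> b \<in> P \<and> (\<forall>x\<in>P. (b, x) \<in> r)"

definition is_maximal :: "'a \<Rightarrow> bool" where
  "is_maximal x \<longleftrightarrow> x \<in> P \<and> (\<forall>y\<in>P. (x, y) \<in> r \<longrightarrow> y = x)"

definition zero_hat :: 'a where
  "zero_hat = (THE b. is_minimum b)"

definition interval :: "'a \<Rightarrow> 'a \<Rightarrow> 'a set" where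
  "interval x y = {z \<in> P. (x, z) \<in> r \<and> (z, y) \<in> r}"

text \<open>The lower interval of \<open>x\<close> is the Boolean lattice on \<open>n\<close> elements.\<close>

definition has_rank :: "'a \<Rightarrow> nat \<Rightarrow> bool" where
  "has_rank x n \<longleftrightarrow>
    (\<exists>f. bij_betw f (interval zero_hat x) (Pow {..<n}) \<and>
      (\<forall>y\<in>interval zero_hat x. \<forall>z\<in>interval zero_hat x. (y, z) \<in> r \<longleftrightarrow> f y \<subseteq> f z))"

definition simplicial_poset :: bool where
  "simplicial_poset \<longleftrightarrow>
    partial_order_on P r \<and> (\<exists>!b. is_minimum b) \<and> (\<forall>x\<in>P. \<exists>n. has_rank x n)"

definition vertices :: "'a set" where
  "vertices = {x \<in> P. has_rank x 1}"

definition edges :: "'a set" where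
  "edges = {x \<in> P. has_rank x 2}"

definition triangles :: "'a set" where
  "triangles = {x \<in> P. has_rank x 3}"

definition pure_2dim :: bool where
  "pure_2dim \<longleftrightarrow> (\<forall>x. is_maximal x \<longrightarrow> x \<in> triangles)"

definition endpoints :: "'a \<Rightarrow> 'a set" where
  "endpoints e = {v \<in> vertices. (v, e) \<in> r}"

definition facets :: "'a \<Rightarrow> 'a set" where
  "facets t = {e \<in> edges. (e, t) \<in> r}"

text \<open>Metrics are functions on the edges: values elsewhere are ignored, and (in)equalities between
  metrics are only required on the edges.\<close>

definition is_metric :: "('a \<Rightarrow> real) \<Rightarrow> bool" where
  "is_metric d \<longleftrightarrow>
    (\<forall>e\<in>edges. 0 \<le> d e) \<and>
    (\<forall>t\<in>triangles. \<forall>e1 e2 e3. facets t = {e1, e2, e3} \<longrightarrow>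
      d e1 + d e2 \<ge> d e3 \<and> d e2 + d e3 \<ge> d e1 \<and> d e1 + d e3 \<ge> d e2)"

definition extreme_metric :: "('a \<Rightarrow> real) \<Rightarrow> bool" where
  "extreme_metric d \<longleftrightarrow>
    is_metric d \<and> (\<exists>e\<in>edges. d e \<noteq> 0) \<and>
    (\<forall>d' d''. is_metric d' \<and> is_metric d'' \<and> (\<forall>e\<in>edges. d e = d' e + d'' e) \<longrightarrow>
      (\<exists>l\<ge>0. \<forall>e\<in>edges. d' e = l * d e))"

definition subgraph :: "'a graph \<Rightarrow> bool" where
  "subgraph G \<longleftrightarrow>
    gverts G \<subseteq> vertices \<and> gedges G \<subseteq> edges \<and> (\<forall>e\<in>gedges G. endpoints e \<subseteq> gverts G)"

fun is_walk :: "'a walk \<Rightarrow> bool" where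
  "is_walk (vs, es) \<longleftrightarrow>
    length vs = length es + 1 \<and> set vs \<subseteq> vertices \<and> set es \<subseteq> edges \<and>
    (\<forall>i<length es. endpoints (es ! i) = {vs ! i, vs ! (i + 1)})"

definition walk_in :: "'a graph \<Rightarrow> 'a walk \<Rightarrow> bool" where
  "walk_in G w \<longleftrightarrow> is_walk w \<and> set (fst w) \<subseteq> gverts G \<and> set (snd w) \<subseteq> gedges G"

fun is_cycle :: "'a walk \<Rightarrow> bool" where
  "is_cycle (vs, es) \<longleftrightarrow> is_walk (vs, es) \<and> distinct es \<and> hd vs = last vs"

inductive elementary_contraction :: "'a walk \<Rightarrow> 'a walk \<Rightarrow> bool" where
  "elementary_contraction
     (vs1 @ [u, v, w] @ vs2, es1 @ [a, b] @ es2)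
     (vs1 @ [u, w] @ vs2, es1 @ [c] @ es2)"
  if "is_walk (vs1 @ [u, v, w] @ vs2, es1 @ [a, b] @ es2)"
    and "length vs1 = length es1"
    and "t \<in> triangles" and "facets t = {a, b, c}"

definition contracts_to :: "'a walk \<Rightarrow> 'a walk \<Rightarrow> bool" where
  "contracts_to = elementary_contraction\<^sup>*\<^sup>*"

text \<open>The one-edge walk along an edge may be traversed in either direction.\<close>

definition contracts_to_edge :: "'a walk \<Rightarrow> 'a \<Rightarrow> bool" where
  "contracts_to_edge w e \<longleftrightarrow> (\<exists>u v. is_walk ([u, v], [e]) \<and> contracts_to w ([u, v], [e]))"

definition bypassing :: "'a graph \<Rightarrow> bool" where
  "bypassing G \<longleftrightarrow>
    vertices \<subseteq> gverts G \<and> (\<forall>e\<in>edges. \<exists>w. walk_in G w \<and> contracts_to_edge w e)"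

definition shortest_walks :: "'a graph \<Rightarrow> 'a \<Rightarrow> 'a walk set" where
  "shortest_walks G e =
    {w. walk_in G w \<and> contracts_to_edge w e \<and>
        (\<forall>w'. walk_in G w' \<and> contracts_to_edge w' e \<longrightarrow> walk_length w \<le> walk_length w')}"

definition graph_metric :: "'a graph \<Rightarrow> 'a \<Rightarrow> real" where
  "graph_metric G e = real (THE m. \<exists>w\<in>shortest_walks G e. m = walk_length w)"

text \<open>The subwalk with \<open>m\<close> edges starting at position \<open>k\<close> of a closed walk, positions being
  read modulo the length of the walk.\<close>

fun arc :: "'a walk \<Rightarrow> nat \<Rightarrow> nat \<Rightarrow> 'a walk" where
  "arc (vs, es) k m =
    (map (\<lambda>j. vs ! ((k + j) mod length es)) [0..<m + 1],
     map (\<lambda>j. es ! ((k + j) mod length es)) [0..<m])"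

fun isometric_even_cycle :: "'a graph \<Rightarrow> nat \<Rightarrow> 'a walk \<Rightarrow> bool" where
  "isometric_even_cycle G n (vs, es) \<longleftrightarrow>
    0 < n \<and> length es = 2 * n \<and> is_cycle (vs, es) \<and> walk_in G (vs, es) \<and>
    (\<forall>i<n. \<exists>f \<in> edges - gedges G. endpoints f = {vs ! i, vs ! (i + n)} \<and>
       arc (vs, es) i n \<in> shortest_walks G f \<and> arc (vs, es) (i + n) n \<in> shortest_walks G f)"

definition opposite_edges :: "'a graph \<Rightarrow> 'a rel" where
  "opposite_edges G =
    {(es ! i, es ! (i + n)) | vs es n i. isometric_even_cycle G n (vs, es) \<and> i < n}"

definition ic_equiv :: "'a graph \<Rightarrow> 'a rel" where
  "ic_equiv G = \<Inter> {R. equiv (gedges G) R \<and> opposite_edges G \<subseteq> R}"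

definition ic_colorable :: "nat \<Rightarrow> 'a graph \<Rightarrow> bool" where
  "ic_colorable k G \<longleftrightarrow> finite (gedges G // ic_equiv G) \<and> card (gedges G // ic_equiv G) = k"

end

end

theory Submission
  imports Defs
begin

text \<open>Let \<open>d = d' + d''\<close> be a decomposition of the graph metric. Contracting a walk in \<open>G\<close> to an
  edge \<open>e\<close> shows that \<open>d' e\<close> and \<open>d'' e\<close> are at most the sums of \<open>d'\<close> and \<open>d''\<close> along the walk;
  for a shortest walk the two bounds add up to an equality, so both are equalities. Hence on an
  isometric even cycle with \<open>d'\<close>-values \<open>x\<^sub>1, \<dots>, x\<^sub>2\<^sub>n\<close> each two complementary arcs of length \<open>n\<close> have
  the same sum, and subtracting the conditions for consecutive positions gives
  \<open>x\<^sub>i = x\<^sub>i\<^sub>+\<^sub>n\<close>. So \<open>d'\<close> is constant on the colour classes; with a single class it is a constant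
  \<open>l\<close> on \<open>G\<close>, and then \<open>d' e = l * d e\<close> for every edge by summing along a shortest walk.\<close>

section \<open>Triangles in simplicial posets\<close>

lemma simplicial_posetD:
  assumes "simplicial_poset P r"
  shows "trans r"
    and "\<And>x. x \<in> P \<Longrightarrow> (zero_hat P r, x) \<in> r"
proof -
  show "trans r"
    using assms by (simp add: simplicial_poset_def partial_order_on_def preorder_on_def)
  have "is_minimum P r (zero_hat P r)"
    using assms unfolding simplicial_poset_def zero_hat_def by (blast intro: theI')
  then show "(zero_hat P r, x) \<in> r" if "x \<in> P" for x
    using that by (simp add: is_minimum_def)
qed

text \<open>Inside the Boolean interval below \<open>t\<close>, the elements below \<open>x\<close>
  correspond to the subsets of \<open>f x\<close>, so the interval below \<open>x\<close> is itself
  Boolean. Rank questions on faces of \<open>t\<close> thus become counting of finite sets.\<close>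

lemma has_rank_iff_card:
  fixes N :: nat
  assumes "trans r"
    and f: "bij_betw f (interval P r (zero_hat P r) t) (Pow {..<N})"
    and mono: "\<And>y z. y \<in> interval P r (zero_hat P r) t \<Longrightarrow> z \<in> interval P r (zero_hat P r) t \<Longrightarrow>
      (y, z) \<in> r \<longleftrightarrow> f y \<subseteq> f z"
    and x: "x \<in> interval P r (zero_hat P r) t"
  shows "has_rank P r x n \<longleftrightarrow> card (f x) = n"
proof -
  let ?I = "interval P r (zero_hat P r)"
  have sub: "?I x \<subseteq> ?I t"
    using x \<open>trans r\<close> unfolding interval_def by (blast dest: transD)
  have Ix: "?I x = {y \<in> ?I t. f y \<subseteq> f x}"
  proof (intro set_eqI iffI)
    fix y assume y: "y \<in> ?I x"
    then have "(y, x) \<in> r"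
      by (simp add: interval_def)
    then show "y \<in> {y \<in> ?I t. f y \<subseteq> f x}"
      using y sub mono[OF _ x] by blast
  next
    fix y assume y: "y \<in> {y \<in> ?I t. f y \<subseteq> f x}"
    then have "(y, x) \<in> r"
      using mono[OF _ x] by blast
    then show "y \<in> ?I x"
      using y by (simp add: interval_def)
  qed
  have fx: "f x \<subseteq> {..<N}"
    using bij_betwE[OF f] x by auto
  then have fin: "finite (f x)"
    using finite_subset[OF _ finite_lessThan] by blast
  have "f ` ?I x = Pow (f x)"
  proof
    show "f ` ?I x \<subseteq> Pow (f x)"
      unfolding Ix by auto
    show "Pow (f x) \<subseteq> f ` ?I x"
    proof
      fix S assume S: "S \<in> Pow (f x)"
      then have "S \<in> f ` ?I t"
        using fx f by (auto simp: bij_betw_def)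
      then show "S \<in> f ` ?I x"
        using S unfolding Ix by auto
    qed
  qed
  then have bij: "bij_betw f (?I x) (Pow (f x))"
    using f sub by (auto simp: bij_betw_def intro: inj_on_subset)
  show ?thesis
  proof
    assume "has_rank P r x n"
    then obtain g where "bij_betw g (?I x) (Pow {..<n})"
      by (auto simp: has_rank_def)
    \<comment> \<open>Cardinalities suffice for this direction: 2 to the power
      \<open>card (f x)\<close> equals 2 to the power \<open>n\<close>, so the exponents
      agree.\<close>
    then have "card (Pow (f x)) = card (Pow {..<n})"
      using bij bij_betw_same_card by metis
    then show "card (f x) = n"
      using fin by (simp add: card_Pow)
  next
    assume "card (f x) = n"
    then obtain h where h: "bij_betw h (f x) {..<n}"
      using fin by (metis card_lessThan finite_lessThan finite_same_card_bij)
    have "bij_betw ((`) h \<circ> f) (?I x) (Pow {..<n})"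
      using bij bij_betw_Pow[OF h] by (rule bij_betw_trans)
    moreover have "(y, z) \<in> r \<longleftrightarrow> h ` f y \<subseteq> h ` f z" if "y \<in> ?I x" "z \<in> ?I x" for y z
    proof -
      \<comment> \<open>Injectivity of \<open>h\<close> on \<open>f x\<close> makes taking images
        reflect inclusion as well as preserve it.\<close>
      have "inj_on h (f x)" "f y \<subseteq> f x" "f z \<subseteq> f x"
        using h that Ix by (auto simp: bij_betw_def)
      then have "h ` f y \<subseteq> h ` f z \<longleftrightarrow> f y \<subseteq> f z"
        by (metis image_mono inj_on_image_mem_iff image_subset_iff subset_iff)
      then show ?thesis
        using mono[of y z] subsetD[OF sub] that by simp
    qed
    ultimately show "has_rank P r x n"
      unfolding has_rank_def by (intro exI[of _ "(`) h \<circ> f"]) auto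
  qed
qed

text \<open>Used to list the faces of a given rank explicitly, as preimages of the subsets of the
  corresponding size.\<close>

lemma bij_betw_Collect_image:
  assumes "bij_betw f A B"
  shows "{x \<in> A. Q (f x)} = inv_into A f ` {y \<in> B. Q y}"
proof
  show "{x \<in> A. Q (f x)} \<subseteq> inv_into A f ` {y \<in> B. Q y}"
  proof
    fix x assume "x \<in> {x \<in> A. Q (f x)}"
    then show "x \<in> inv_into A f ` {y \<in> B. Q y}"
      using assms by (intro image_eqI[of _ _ "f x"]) (auto simp: bij_betw_inv_into_left bij_betwE)
  qed
  show "inv_into A f ` {y \<in> B. Q y} \<subseteq> {x \<in> A. Q (f x)}"
    using assms bij_betwE[OF bij_betw_inv_into[OF assms]] by (auto simp: bij_betw_inv_into_right)
qed

lemma card_one_subset_3: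
  fixes S :: "nat set"
  shows "S \<subseteq> {..<3} \<and> card S = 1 \<longleftrightarrow> S = {0} \<or> S = {1} \<or> S = {2}"
  by (auto simp: card_1_singleton_iff)

lemma card_two_subset_3:
  fixes S :: "nat set"
  shows "S \<subseteq> {..<3} \<and> card S = 2 \<longleftrightarrow> S = {0, 1} \<or> S = {1, 2} \<or> S = {0, 2}"
proof
  assume "S \<subseteq> {..<3} \<and> card S = 2"
  moreover from this obtain i j where "S = {i, j}" "i \<noteq> j"
    by (auto simp: card_2_iff)
  ultimately have "i < 3" "j < 3"
    by auto
  then have "i = 0 \<or> i = 1 \<or> i = 2" "j = 0 \<or> j = 1 \<or> j = 2"
    by auto
  with \<open>S = {i, j}\<close> \<open>i \<noteq> j\<close> show "S = {0, 1} \<or> S = {1, 2} \<or> S = {0, 2}"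
    by auto
qed auto

text \<open>The facets of \<open>t\<close> correspond to the three two-element subsets of a
  three-element set, and their endpoints to singletons. The order in which the facets are named is
  arbitrary, so every choice of \<open>a\<close>, \<open>b\<close>, \<open>c\<close> is
  covered.\<close>

lemma triangle_endpoints:
  assumes P: "simplicial_poset P r" and t: "t \<in> triangles P r" and abc: "facets P r t = {a, b, c}"
  obtains u v w where "u \<noteq> v" "v \<noteq> w" "u \<noteq> w"
    and "endpoints P r a = {u, v}" "endpoints P r b = {v, w}" "endpoints P r c = {u, w}"
proof -
  let ?I = "interval P r (zero_hat P r) t"
  note tr = simplicial_posetD(1)[OF P] and zero = simplicial_posetD(2)[OF P]
  from t obtain f where f: "bij_betw f ?I (Pow {..<3::nat})"
    and mono: "\<And>y z. y \<in> ?I \<Longrightarrow> z \<in> ?I \<Longrightarrow> (y, z) \<in> r \<longleftrightarrow> f y \<subseteq> f z"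
    unfolding triangles_def has_rank_def by blast
  note rank = has_rank_iff_card[OF tr f mono]
  \<comment> \<open>\<open>p S\<close> is the face of \<open>t\<close> whose set of vertex labels is
    \<open>S\<close>.\<close>
  define p where "p = inv_into ?I f"
  have p: "p S \<in> ?I" "f (p S) = S" if "S \<subseteq> {..<3}" for S
    using bij_betwE[OF bij_betw_inv_into[OF f]] bij_betw_inv_into_right[OF f] that
    by (simp_all add: p_def)
  have image: "{x \<in> ?I. Q (f x)} = p ` {S. S \<subseteq> {..<3} \<and> Q S}" for Q
    using bij_betw_Collect_image[OF f, of Q] by (simp add: p_def)
  have facets: "x \<in> facets P r t \<longleftrightarrow> x \<in> ?I \<and> card (f x) = 2" for x
    using rank[of x 2] zero by (auto simp: facets_def edges_def interval_def)
  have ends: "x \<in> endpoints P r e \<longleftrightarrow> x \<in> ?I \<and> card (f x) = 1 \<and> f x \<subseteq> f e" if "e \<in> ?I" for x e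
  proof -
    \<comment> \<open>By transitivity, whatever lies below a face of \<open>t\<close> is again a
      face of \<open>t\<close>, so no endpoint is missed.\<close>
    have "x \<in> ?I" if "x \<in> P" "(x, e) \<in> r"
      using that \<open>e \<in> ?I\<close> tr zero unfolding interval_def by (auto elim: transE)
    moreover have "x \<in> P" if "x \<in> ?I"
      using that by (simp add: interval_def)
    ultimately show ?thesis
      using rank[of x 1] mono[of x e] that by (auto simp: endpoints_def vertices_def)
  qed
  have "facets P r t = p ` {S. S \<subseteq> {..<3} \<and> card S = 2}"
    using image[of "\<lambda>S. card S = 2"] facets by blast
  then have facets_eq: "{a, b, c} = {p {0, 1}, p {1, 2}, p {0, 2}}"
    unfolding abc card_two_subset_3 by auto
  have ends_eq: "endpoints P r (p S) = p ` {T. (T \<subseteq> {..<3} \<and> card T = 1) \<and> T \<subseteq> S}"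
    if "S \<subseteq> {..<3}" for S
  proof -
    have "endpoints P r (p S) = {x \<in> ?I. card (f x) = 1 \<and> f x \<subseteq> S}"
      using ends[OF p(1)[OF that]] p(2)[OF that] by blast
    then show ?thesis
      using image[of "\<lambda>T. card T = 1 \<and> T \<subseteq> S"] by (simp only: conj_assoc)
  qed
  have E: "endpoints P r (p {0, 1}) = {p {0}, p {1}}"
    "endpoints P r (p {1, 2}) = {p {1}, p {2}}"
    "endpoints P r (p {0, 2}) = {p {0}, p {2}}"
  proof -
    have "{T. (T \<subseteq> {..<3} \<and> card T = 1) \<and> T \<subseteq> {0, 1}} = {{0::nat}, {1}}"
      "{T. (T \<subseteq> {..<3} \<and> card T = 1) \<and> T \<subseteq> {1, 2}} = {{1::nat}, {2}}"
      "{T. (T \<subseteq> {..<3} \<and> card T = 1) \<and> T \<subseteq> {0, 2}} = {{0::nat}, {2}}"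
      unfolding card_one_subset_3 by auto
    then show "endpoints P r (p {0, 1}) = {p {0}, p {1}}"
      "endpoints P r (p {1, 2}) = {p {1}, p {2}}"
      "endpoints P r (p {0, 2}) = {p {0}, p {2}}"
      using ends_eq[of "{0, 1}"] ends_eq[of "{1, 2}"] ends_eq[of "{0, 2}"] by simp_all
  qed
  have inj: "p S = p T \<longleftrightarrow> S = T" if "S \<subseteq> {..<3}" "T \<subseteq> {..<3}" for S T
    using p that by metis
  have D: "p {0} \<noteq> p {1}" "p {1} \<noteq> p {2}" "p {0} \<noteq> p {2}"
    and D': "p {0, 1} \<noteq> p {1, 2}" "p {1, 2} \<noteq> p {0, 2}" "p {0, 1} \<noteq> p {0, 2}"
    by (simp_all add: inj doubleton_eq_iff)
  have "\<exists>u v w. u \<noteq> v \<and> v \<noteq> w \<and> u \<noteq> w \<and>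
      endpoints P r x = {u, v} \<and> endpoints P r y = {v, w} \<and> endpoints P r z = {u, w}"
    if "{x, y, z} = {p {0, 1}, p {1, 2}, p {0, 2}}" for x y z
  proof -
    \<comment> \<open>The count excludes repetitions among \<open>x\<close>, \<open>y\<close>,
      \<open>z\<close>, leaving the six permutations; each is settled by permuting the three corners
      accordingly.\<close>
    have "card {x, y, z} = 3"
      using D' unfolding that by simp
    then have "x \<noteq> y" "y \<noteq> z" "x \<noteq> z"
      by (auto simp: card_insert_if split: if_splits)
    moreover have "x \<in> {p {0, 1}, p {1, 2}, p {0, 2}}" "y \<in> {p {0, 1}, p {1, 2}, p {0, 2}}"
      "z \<in> {p {0, 1}, p {1, 2}, p {0, 2}}"
      using that by blast+
    ultimately consider "x = p {0, 1}" "y = p {1, 2}" "z = p {0, 2}"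
      | "x = p {0, 1}" "z = p {1, 2}" "y = p {0, 2}"
      | "y = p {0, 1}" "x = p {1, 2}" "z = p {0, 2}"
      | "y = p {0, 1}" "z = p {1, 2}" "x = p {0, 2}"
      | "z = p {0, 1}" "x = p {1, 2}" "y = p {0, 2}"
      | "z = p {0, 1}" "y = p {1, 2}" "x = p {0, 2}"
      by auto
    then show ?thesis
    proof cases
      case 1
      with D E show ?thesis
        by (intro exI[of _ "p {0}"] exI[of _ "p {1}"] exI[of _ "p {2}"]) auto
    next
      case 2
      with D E show ?thesis
        by (intro exI[of _ "p {1}"] exI[of _ "p {0}"] exI[of _ "p {2}"]) auto
    next
      case 3
      with D E show ?thesis
        by (intro exI[of _ "p {2}"] exI[of _ "p {1}"] exI[of _ "p {0}"]) auto
    next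
      case 4
      with D E show ?thesis
        by (intro exI[of _ "p {2}"] exI[of _ "p {0}"] exI[of _ "p {1}"]) auto
    next
      case 5
      with D E show ?thesis
        by (intro exI[of _ "p {1}"] exI[of _ "p {2}"] exI[of _ "p {0}"]) auto
    next
      case 6
      with D E show ?thesis
        by (intro exI[of _ "p {0}"] exI[of _ "p {2}"] exI[of _ "p {1}"]) auto
    qed
  qed
  from this[OF facets_eq] that show ?thesis
    by blast
qed

section \<open>Walks and contractions\<close>

lemma is_walk_rev: "is_walk P r (vs, es) \<Longrightarrow> is_walk P r (rev vs, rev es)"
proof -
  assume w: "is_walk P r (vs, es)"
  have "endpoints P r (rev es ! i) = {rev vs ! i, rev vs ! (i + 1)}" if "i < length es" for i
  proof -
    \<comment> \<open>Edge \<open>i\<close> of the reversed walk is edge \<open>j\<close> of the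
      original one, with its two vertices \<open>j\<close> and \<open>j + 1\<close> met in the
      opposite order.\<close>
    define j where "j = length es - Suc i"
    have "j < length es" "length vs - Suc i = j + 1" "length vs - Suc (i + 1) = j"
      using that w by (auto simp: j_def)
    then show ?thesis
      using w that by (auto simp: rev_nth j_def[symmetric])
  qed
  then show ?thesis
    using w by simp
qed

text \<open>The common vertex \<open>y\<close> is listed once in the glued walk, which keeps the
  vertex list exactly one longer than the edge list.\<close>

lemma is_walk_append:
  assumes "is_walk P r (vs @ [y], es)" and "is_walk P r (y # vs', es')"
  shows "is_walk P r (vs @ y # vs', es @ es')"
proof -
  have len: "length vs = length es"
    using assms(1) by simp
  have "endpoints P r ((es @ es') ! i) = {(vs @ y # vs') ! i, (vs @ y # vs') ! (i + 1)}"
    if "i < length (es @ es')" for i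
  proof (cases "i < length es")
    case True
    then have "endpoints P r (es ! i) = {(vs @ [y]) ! i, (vs @ [y]) ! (i + 1)}"
      using assms(1) by simp
    then show ?thesis
      using True len by (auto simp: nth_append split: if_splits)
  next
    case False
    define j where "j = i - length es"
    have j: "i = length es + j" "j < length es'"
      using False that by (auto simp: j_def)
    then have "endpoints P r (es' ! j) = {(y # vs') ! j, (y # vs') ! (j + 1)}"
      using assms(2) by simp
    then show ?thesis
      using j len by (simp add: nth_append)
  qed
  then show ?thesis
    using assms by auto
qed

text \<open>The length condition aligns the cut of the edge list with the position of
  \<open>y\<close> in the vertex list.\<close>

lemma is_walk_appendD:
  assumes "is_walk P r (vs @ y # vs', es @ es')" and len: "length vs = length es"
  shows "is_walk P r (vs @ [y], es)" and "is_walk P r (y # vs', es')"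
proof -
  have E: "endpoints P r ((es @ es') ! i) = {(vs @ y # vs') ! i, (vs @ y # vs') ! (i + 1)}"
    if "i < length es + length es'" for i
    using assms that by simp
  have "endpoints P r (es ! i) = {(vs @ [y]) ! i, (vs @ [y]) ! (i + 1)}" if "i < length es" for i
    using E[of i] that len by (auto simp: nth_append split: if_splits)
  then show "is_walk P r (vs @ [y], es)"
    using assms by auto
  have "endpoints P r (es' ! i) = {(y # vs') ! i, (y # vs') ! (i + 1)}" if "i < length es'" for i
    using E[of "length es + i"] that len by (simp add: nth_append)
  then show "is_walk P r (y # vs', es')"
    using assms by auto
qed

lemma is_walk_edge:
  "is_walk P r ([u, v], [e]) \<longleftrightarrow>
    u \<in> vertices P r \<and> v \<in> vertices P r \<and> e \<in> edges P r \<and> endpoints P r e = {u, v}"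
  by auto

text \<open>The rule for contractions demands a walk only on its left side. On the right,
  \<open>c\<close> must join \<open>u\<close> and \<open>w\<close>: the corners of the triangle are
  distinct, so \<open>v\<close> is the only endpoint shared by \<open>a\<close> and
  \<open>b\<close>, and \<open>c\<close> joins the other two.\<close>

lemma elementary_contraction_is_walk:
  assumes P: "simplicial_poset P r" and "elementary_contraction P r x y"
  shows "is_walk P r y"
  using assms(2)
proof cases
  case (1 vs1 u v w vs2 es1 a b es2 t c)
  have "is_walk P r (vs1 @ u # (v # w # vs2), es1 @ ([a] @ [b] @ es2))"
    using 1 by simp
  from is_walk_appendD[OF this] 1 have w1: "is_walk P r (vs1 @ [u], es1)"
    and w2: "is_walk P r ([u] @ v # (w # vs2), [a] @ ([b] @ es2))"
    by simp_all
  from is_walk_appendD[OF w2] have a: "is_walk P r ([u, v], [a])"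
    and w3: "is_walk P r ([v] @ w # vs2, [b] @ es2)"
    by simp_all
  from is_walk_appendD[OF w3] have b: "is_walk P r ([v, w], [b])"
    and w4: "is_walk P r (w # vs2, es2)"
    by simp_all
  obtain u' v' w' where "u' \<noteq> v'" "v' \<noteq> w'" "u' \<noteq> w'"
    "endpoints P r a = {u', v'}" "endpoints P r b = {v', w'}" "endpoints P r c = {u', w'}"
    using triangle_endpoints[OF P \<open>t \<in> triangles P r\<close> \<open>facets P r t = {a, b, c}\<close>] by metis
  moreover have "endpoints P r a = {u, v}" "endpoints P r b = {v, w}"
    using a b by (simp_all add: is_walk_edge)
  ultimately have "endpoints P r c = {u, w}"
    by (auto simp: doubleton_eq_iff)
  moreover have "c \<in> edges P r"
    using 1 by (auto simp: facets_def)
  ultimately have "is_walk P r ([u] @ [w], [c])"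
    using a b by (simp add: is_walk_edge)
  from is_walk_append[OF this w4] have "is_walk P r (u # (w # vs2), [c] @ es2)"
    by simp
  from is_walk_append[OF w1 this] show ?thesis
    using 1 by simp
qed

lemma elementary_contraction_append:
  assumes "elementary_contraction P r (vs, es) (vs', es')"
    and "is_walk P r (xs @ vs @ ys, as @ es @ bs)" and len: "length xs = length as"
  shows "elementary_contraction P r (xs @ vs @ ys, as @ es @ bs) (xs @ vs' @ ys, as @ es' @ bs)"
  using assms(1)
proof cases
  case (1 vs1 u v w vs2 es1 a b es2 t c)
  show ?thesis
    using elementary_contraction.intros[of P r "xs @ vs1" u v w "vs2 @ ys" "as @ es1" a b "es2 @ bs" t c]
      1 assms(2) len by simp
qed

text \<open>A contraction may be carried out in the middle of a longer walk. Only the initial long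
  walk has to be checked, since contraction preserves walks.\<close>

lemma contracts_to_append:
  assumes P: "simplicial_poset P r" and "contracts_to P r (vs, es) (vs', es')"
    and "is_walk P r (xs @ vs @ ys, as @ es @ bs)" and len: "length xs = length as"
  shows "contracts_to P r (xs @ vs @ ys, as @ es @ bs) (xs @ vs' @ ys, as @ es' @ bs)"
proof -
  have "(elementary_contraction P r)\<^sup>*\<^sup>* (vs, es) (vs', es')"
    using assms(2) by (simp add: contracts_to_def)
  then have "(elementary_contraction P r)\<^sup>*\<^sup>*
    (xs @ vs @ ys, as @ es @ bs) (xs @ vs' @ ys, as @ es' @ bs)"
    using assms(3)
  \<comment> \<open>Induction runs from the front of the chain, because the walk hypothesis concerns
    its first member and is handed on step by step.\<close>
  proof (induction rule: converse_rtranclp_induct2)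
    case refl
    show ?case by simp
  next
    case (step us cs us' cs')
    have "elementary_contraction P r (xs @ us @ ys, as @ cs @ bs) (xs @ us' @ ys, as @ cs' @ bs)"
      using elementary_contraction_append step.hyps(1) step.prems len by metis
    moreover from elementary_contraction_is_walk[OF P this] step.IH
    have "(elementary_contraction P r)\<^sup>*\<^sup>*
      (xs @ us' @ ys, as @ cs' @ bs) (xs @ vs' @ ys, as @ es' @ bs)"
      by blast
    ultimately show ?case
      by (rule converse_rtranclp_into_rtranclp)
  qed
  then show ?thesis
    by (simp add: contracts_to_def)
qed

lemma elementary_contraction_rev:
  assumes "elementary_contraction P r (vs, es) (vs', es')"
  shows "elementary_contraction P r (rev vs, rev es) (rev vs', rev es')"
  using assms
proof cases
  case (1 vs1 u v w vs2 es1 a b es2 t c)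
  have "length vs2 = length es2"
    using 1 by simp
  then show ?thesis
    using elementary_contraction.intros[of P r "rev vs2" w v u "rev vs1" "rev es2" b a "rev es1" t c]
      1 is_walk_rev[of P r vs es] by (simp add: insert_commute)
qed

text \<open>Facets form an unordered set, so each elementary contraction can be read backwards along
  the walk. This lets a shortest walk be oriented as desired.\<close>

lemma contracts_to_rev:
  assumes "contracts_to P r (vs, es) (vs', es')"
  shows "contracts_to P r (rev vs, rev es) (rev vs', rev es')"
proof -
  have "(elementary_contraction P r)\<^sup>*\<^sup>* (vs, es) (vs', es')"
    using assms by (simp add: contracts_to_def)
  then have "(elementary_contraction P r)\<^sup>*\<^sup>* (rev vs, rev es) (rev vs', rev es')"
    by (induction rule: rtranclp_induct2)
      (auto intro: rtranclp.rtrancl_into_rtrancl elementary_contraction_rev)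
  then show ?thesis
    by (simp add: contracts_to_def)
qed

text \<open>A contraction deletes only the vertex \<open>v\<close> between \<open>u\<close> and
  \<open>w\<close>, never an end of the walk.\<close>

lemma contracts_to_hd_last:
  assumes "contracts_to P r w w'"
  shows "hd (fst w) = hd (fst w')" and "last (fst w) = last (fst w')"
proof -
  have "(elementary_contraction P r)\<^sup>*\<^sup>* w w'"
    using assms by (simp add: contracts_to_def)
  then have "hd (fst w) = hd (fst w') \<and> last (fst w) = last (fst w')"
  proof induction
    case (step y z)
    from step.hyps(2) have "hd (fst y) = hd (fst z) \<and> last (fst y) = last (fst z)"
      by cases (auto simp: hd_append)
    with step.IH show ?case by simp
  qed simp
  then show "hd (fst w) = hd (fst w')" "last (fst w) = last (fst w')"
    by simp_all
qed

text \<open>Either the walk already is the one-edge walk, or a first contraction applies to it and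
  needs two edges.\<close>

lemma contracts_to_edge_length_pos:
  assumes "contracts_to_edge P r w e"
  shows "0 < walk_length w"
proof -
  obtain u v where "(elementary_contraction P r)\<^sup>*\<^sup>* w ([u, v], [e])"
    using assms by (auto simp: contracts_to_edge_def contracts_to_def)
  then show ?thesis
  proof (cases rule: converse_rtranclpE)
    case (step y)
    from step(1) show ?thesis
      by cases (simp add: walk_length_def)
  qed (simp add: walk_length_def)
qed

text \<open>By the triangle inequality, no elementary contraction increases the total
  \<open>d\<close>-length of a walk.\<close>

lemma contracts_to_edge_metric_le:
  assumes d: "is_metric P r d" and "contracts_to_edge P r w e"
  shows "d e \<le> sum_list (map d (snd w))"
proof -
  have step: "sum_list (map d (snd y)) \<le> sum_list (map d (snd x))"
    if "elementary_contraction P r x y" for x y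
    using that
  proof cases
    case (1 vs1 u v w vs2 es1 a b es2 t c)
    then have "d c \<le> d a + d b"
      using d by (auto simp: is_metric_def)
    then show ?thesis
      using 1 by simp
  qed
  have "sum_list (map d (snd y)) \<le> sum_list (map d (snd x))"
    if "(elementary_contraction P r)\<^sup>*\<^sup>* x y" for x y
    using that by induction (auto dest: step)
  moreover obtain u v where "(elementary_contraction P r)\<^sup>*\<^sup>* w ([u, v], [e])"
    using assms(2) by (auto simp: contracts_to_edge_def contracts_to_def)
  ultimately have "sum_list (map d (snd ([u, v], [e]))) \<le> sum_list (map d (snd w))"
    by blast
  then show ?thesis
    by simp
qed

section \<open>The graph metric\<close>

text \<open>Two shortest walks bound each other's length, so the definite description is determined
  by any one of them.\<close>

lemma graph_metric_shortest:
  assumes "w \<in> shortest_walks P r G e"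
  shows "graph_metric P r G e = real (walk_length w)"
proof -
  have "walk_length w' = walk_length w" if "w' \<in> shortest_walks P r G e" for w'
    using assms that unfolding shortest_walks_def by (blast intro: le_antisym)
  then have "(THE m. \<exists>w\<in>shortest_walks P r G e. m = walk_length w) = walk_length w"
    using assms by (intro the_equality) blast+
  then show ?thesis
    by (simp add: graph_metric_def)
qed

lemma bypassing_shortest_walk:
  assumes "bypassing P r G" and "e \<in> edges P r"
  obtains w where "w \<in> shortest_walks P r G e"
proof -
  let ?Q = "\<lambda>w. walk_in P r G w \<and> contracts_to_edge P r w e"
  from assms obtain w0 where "?Q w0"
    by (auto simp: bypassing_def)
  from ex_has_least_nat[of ?Q, OF this, of walk_length] that show thesis
    unfolding shortest_walks_def by blast
qed

lemma graph_metric_le: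
  assumes G: "bypassing P r G" and "e \<in> edges P r"
    and "walk_in P r G w" and "contracts_to_edge P r w e"
  shows "graph_metric P r G e \<le> real (walk_length w)"
proof -
  obtain w' where w': "w' \<in> shortest_walks P r G e"
    using bypassing_shortest_walk[OF assms(1,2)] .
  then have "walk_length w' \<le> walk_length w"
    using assms unfolding shortest_walks_def by blast
  then show ?thesis
    using graph_metric_shortest[OF w'] by simp
qed

lemma edge_endpoint_vertex: "endpoints P r e = {u, v} \<Longrightarrow> u \<in> vertices P r \<and> v \<in> vertices P r"
  by (auto simp: endpoints_def)

text \<open>\<open>contracts_to_edge\<close> leaves the direction of traversal open. Reversing if
  necessary fixes the direction from \<open>u\<close> to \<open>v\<close>, so that shortest walks of
  adjacent edges can be concatenated.\<close>

lemma shortest_walk_between: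
  assumes G: "bypassing P r G" and e: "e \<in> edges P r" and ends: "endpoints P r e = {u, v}"
  obtains vs es where "walk_in P r G (vs, es)" "contracts_to P r (vs, es) ([u, v], [e])"
    "graph_metric P r G e = real (length es)"
proof -
  obtain vs es where w: "(vs, es) \<in> shortest_walks P r G e"
    using bypassing_shortest_walk[OF G e] by (metis surj_pair)
  have len: "graph_metric P r G e = real (length es)"
    using graph_metric_shortest[OF w] by (simp add: walk_length_def)
  have win: "walk_in P r G (vs, es)"
    using w by (simp add: shortest_walks_def)
  obtain x y where xy: "is_walk P r ([x, y], [e])" "contracts_to P r (vs, es) ([x, y], [e])"
    using w by (auto simp: shortest_walks_def contracts_to_edge_def)
  then have "{x, y} = {u, v}"
    using ends by (simp add: is_walk_edge)
  then consider "x = u" "y = v" | "x = v" "y = u"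
    by (auto simp: doubleton_eq_iff)
  then show ?thesis
  proof cases
    case 1
    then show ?thesis
      using that[OF win _ len] xy by simp
  next
    case 2
    have "walk_in P r G (rev vs, rev es)"
      using win is_walk_rev[of P r vs es] by (simp add: walk_in_def)
    moreover have "contracts_to P r (rev vs, rev es) ([u, v], [e])"
      using contracts_to_rev[OF xy(2)] 2 by simp
    ultimately show ?thesis
      using that len by simp
  qed
qed

text \<open>Shortest walks for \<open>a\<close> and \<open>b\<close>, joined at the common corner,
  contract first to \<open>a\<close> followed by \<open>b\<close> and then across \<open>t\<close>
  to \<open>c\<close>. The joined walk therefore competes in the minimum for
  \<open>c\<close>.\<close>

lemma graph_metric_triangle:
  assumes P: "simplicial_poset P r" and G: "bypassing P r G"
    and t: "t \<in> triangles P r" and abc: "facets P r t = {a, b, c}"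
  shows "graph_metric P r G c \<le> graph_metric P r G a + graph_metric P r G b"
proof -
  obtain u v w where ends:
    "endpoints P r a = {u, v}" "endpoints P r b = {v, w}" "endpoints P r c = {u, w}"
    using triangle_endpoints[OF P t abc] by metis
  have edges: "a \<in> edges P r" "b \<in> edges P r" "c \<in> edges P r"
    using abc by (auto simp: facets_def)
  obtain vs es where a: "walk_in P r G (vs, es)" "contracts_to P r (vs, es) ([u, v], [a])"
    "graph_metric P r G a = real (length es)"
    using shortest_walk_between[OF G edges(1) ends(1)] .
  obtain vs' es' where b: "walk_in P r G (vs', es')" "contracts_to P r (vs', es') ([v, w], [b])"
    "graph_metric P r G b = real (length es')"
    using shortest_walk_between[OF G edges(2) ends(2)] .
  have "vs \<noteq> []" "vs' \<noteq> []"
    using a b by (auto simp: walk_in_def)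
  moreover have "last vs = v" "hd vs' = v"
    using contracts_to_hd_last(2)[OF a(2)] contracts_to_hd_last(1)[OF b(2)] by simp_all
  ultimately obtain xs ys where vs: "vs = xs @ [v]" and vs': "vs' = v # ys"
    by (metis append_butlast_last_id list.collapse)
  have walk: "is_walk P r (vs @ ys, es @ es')"
    using is_walk_append[of P r xs v es ys es'] a b vs vs' by (simp add: walk_in_def)
  \<comment> \<open>The front part is contracted to \<open>a\<close> while the rest stays fixed;
    afterwards the rest is contracted to \<open>b\<close> behind \<open>a\<close>.\<close>
  have "contracts_to P r (vs @ ys, es @ es') ([u, v] @ ys, [a] @ es')"
    using contracts_to_append[OF P a(2), of "[]" ys "[]" es'] walk by simp
  moreover have "is_walk P r ([u] @ v # ys, [a] @ es')"
    using b(1) vs' ends edges edge_endpoint_vertex[OF ends(1)]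
    by (intro is_walk_append) (auto simp: walk_in_def is_walk_edge)
  then have "contracts_to P r ([u, v] @ ys, [a] @ es') ([u] @ [v, w], [a] @ [b])"
    using contracts_to_append[OF P b(2), of "[u]" "[]" "[a]" "[]"] vs' by simp
  moreover have "is_walk P r ([u] @ v # [w], [a] @ [b])"
    using ends edges edge_endpoint_vertex[OF ends(1)] edge_endpoint_vertex[OF ends(2)]
    by (intro is_walk_append) (auto simp: is_walk_edge)
  then have "elementary_contraction P r ([u] @ [v, w], [a] @ [b]) ([u, w], [c])"
    using elementary_contraction.intros[of P r "[]" u v w "[]" "[]" a b "[]" t c] t abc by simp
  then have "contracts_to P r ([u] @ [v, w], [a] @ [b]) ([u, w], [c])"
    by (simp add: contracts_to_def)
  ultimately have "contracts_to P r (vs @ ys, es @ es') ([u, w], [c])"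
    unfolding contracts_to_def by (meson rtranclp_trans)
  moreover have "is_walk P r ([u, w], [c])"
    using ends edges edge_endpoint_vertex[OF ends(3)] by (simp add: is_walk_edge)
  ultimately have "contracts_to_edge P r (vs @ ys, es @ es') c"
    unfolding contracts_to_edge_def by blast
  moreover have "walk_in P r G (vs @ ys, es @ es')"
    using walk a(1) b(1) vs' by (auto simp: walk_in_def)
  ultimately have "graph_metric P r G c \<le> real (walk_length (vs @ ys, es @ es'))"
    using graph_metric_le[OF G edges(3)] by blast
  then show ?thesis
    using a(3) b(3) by (simp add: walk_length_def)
qed

lemma graph_metric_is_metric:
  assumes P: "simplicial_poset P r" and G: "bypassing P r G"
  shows "is_metric P r (graph_metric P r G)"
  unfolding is_metric_def
proof (intro conjI ballI allI impI)
  fix t a b c assume t: "t \<in> triangles P r" and abc: "facets P r t = {a, b, c}"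
  note triangle = graph_metric_triangle[OF P G t]
  have "facets P r t = {b, c, a}" "facets P r t = {a, c, b}"
    using abc by auto
  with abc show "graph_metric P r G c \<le> graph_metric P r G a + graph_metric P r G b"
    "graph_metric P r G a \<le> graph_metric P r G b + graph_metric P r G c"
    "graph_metric P r G b \<le> graph_metric P r G a + graph_metric P r G c"
    by (simp_all only: triangle)
qed (simp add: graph_metric_def)

lemma edge_two_endpoints:
  assumes P: "simplicial_poset P r" and e: "e \<in> edges P r"
  obtains u v where "endpoints P r e = {u, v}"
proof -
  let ?I = "interval P r (zero_hat P r) e"
  note tr = simplicial_posetD(1)[OF P] and zero = simplicial_posetD(2)[OF P]
  from e obtain f where f: "bij_betw f ?I (Pow {..<2::nat})"
    and mono: "\<And>y z. y \<in> ?I \<Longrightarrow> z \<in> ?I \<Longrightarrow> (y, z) \<in> r \<longleftrightarrow> f y \<subseteq> f z"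
    unfolding edges_def has_rank_def by blast
  note rank = has_rank_iff_card[OF tr f mono]
  have "endpoints P r e = {x \<in> ?I. card (f x) = 1}"
    using rank[of _ 1] zero by (auto simp: endpoints_def vertices_def interval_def)
  also have "\<dots> = inv_into ?I f ` {S \<in> Pow {..<2}. card S = 1}"
    by (rule bij_betw_Collect_image[OF f])
  also have "{S \<in> Pow {..<2::nat}. card S = 1} = {{0}, {1}}"
    by (auto simp: card_1_singleton_iff)
  finally show ?thesis
    using that by simp
qed

text \<open>The one-edge walk gives the upper bound, and positivity of the length of contractible
  walks gives the lower one.\<close>

lemma graph_metric_edge:
  assumes P: "simplicial_poset P r" and "subgraph P r G" and G: "bypassing P r G"
    and e: "e \<in> gedges G"
  shows "graph_metric P r G e = 1"
proof -
  have E: "e \<in> edges P r"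
    using assms by (auto simp: subgraph_def)
  obtain u v where ends: "endpoints P r e = {u, v}"
    using edge_two_endpoints[OF P E] .
  have w: "is_walk P r ([u, v], [e])"
    using ends E edge_endpoint_vertex[OF ends] by (simp add: is_walk_edge)
  moreover have "{u, v} \<subseteq> gverts G"
    using assms(2) e ends by (auto simp: subgraph_def)
  ultimately have "walk_in P r G ([u, v], [e])"
    using e by (simp add: walk_in_def)
  moreover have "contracts_to_edge P r ([u, v], [e]) e"
    using w unfolding contracts_to_edge_def contracts_to_def by blast
  ultimately have "graph_metric P r G e \<le> 1"
    using graph_metric_le[OF G E] by (fastforce simp: walk_length_def)
  moreover obtain w where w: "w \<in> shortest_walks P r G e"
    using bypassing_shortest_walk[OF G E] .
  then have "0 < walk_length w"
    using contracts_to_edge_length_pos[of P r w e] by (simp add: shortest_walks_def)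
  then have "1 \<le> graph_metric P r G e"
    using graph_metric_shortest[OF w] by simp
  ultimately show ?thesis
    by simp
qed

section \<open>Decompositions of the graph metric\<close>

lemma summand_sum_shortest_walk:
  assumes P: "simplicial_poset P r" and sub: "subgraph P r G" and G: "bypassing P r G"
    and d': "is_metric P r d'" and d'': "is_metric P r d''"
    and sum: "\<And>e. e \<in> edges P r \<Longrightarrow> graph_metric P r G e = d' e + d'' e"
    and e: "e \<in> edges P r" and w: "w \<in> shortest_walks P r G e"
  shows "d' e = sum_list (map d' (snd w))"
proof -
  have con: "contracts_to_edge P r w e" and win: "set (snd w) \<subseteq> gedges G"
    using w by (auto simp: shortest_walks_def walk_in_def)
  have "d' e \<le> sum_list (map d' (snd w))" "d'' e \<le> sum_list (map d'' (snd w))"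
    using contracts_to_edge_metric_le[OF _ con] d' d'' by simp_all
  \<comment> \<open>All edges of \<open>w\<close> lie in \<open>G\<close>, where
    \<open>d' + d''\<close> equals 1. The two sums thus add up to the length of \<open>w\<close>,
    which is the graph metric of \<open>e\<close>.\<close>
  moreover have "sum_list (map d' (snd w)) + sum_list (map d'' (snd w)) = d' e + d'' e"
  proof -
    have "d' x + d'' x = 1" if "x \<in> set (snd w)" for x
    proof -
      have "x \<in> gedges G" "x \<in> edges P r"
        using that win sub by (auto simp: subgraph_def)
      then show ?thesis
        using graph_metric_edge[OF P sub G] sum by metis
    qed
    then have "map (\<lambda>x. d' x + d'' x) (snd w) = map (\<lambda>_. 1) (snd w)"
      by simp
    then have "sum_list (map (\<lambda>x. d' x + d'' x) (snd w)) = real (length (snd w))"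
      by (simp only: sum_list_triv mult_1_right)
    then show ?thesis
      using graph_metric_shortest[OF w] sum[OF e] by (simp add: sum_list_addf walk_length_def)
  qed
  ultimately show ?thesis
    by linarith
qed

text \<open>Moving both complementary windows one step from position \<open>i\<close> changes the
  difference of their sums by twice \<open>x (i + n) - x i\<close>. The difference is zero before
  and after, so the two values agree.\<close>

lemma opposite_values_eq:
  fixes x :: "nat \<Rightarrow> real"
  assumes arcs: "\<And>i. i < n \<Longrightarrow>
      (\<Sum>j<n. x ((i + j) mod (2 * n))) = (\<Sum>j<n. x ((i + n + j) mod (2 * n)))"
    and i: "i < n"
  shows "x i = x (i + n)"
proof -
  \<comment> \<open>\<open>y\<close> is the periodic extension of \<open>x\<close>, and
    \<open>s k\<close> below is the sum over the window of length \<open>n\<close> starting at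
    \<open>k\<close>.\<close>
  define y where "y k = x (k mod (2 * n))" for k
  define s where "s k = (\<Sum>j<n. y (k + j))" for k
  have period: "y (k + 2 * n) = y k" for k
    by (simp add: y_def)
  have shift: "s (Suc k) = s k - y k + y (k + n)" for k
  proof -
    have "y k + (\<Sum>j<n. y (k + Suc j)) = (\<Sum>j<n. y (k + j)) + y (k + n)"
      using sum.lessThan_Suc_shift[of "\<lambda>j. y (k + j)" n] by simp
    then show ?thesis
      by (simp add: s_def)
  qed
  have "s (k + 2 * n) = s k" for k
  proof -
    have "y (k + 2 * n + j) = y (k + j)" for j
      using period[of "k + j"] by (simp only: ac_simps)
    then show ?thesis
      by (simp add: s_def)
  qed
  from this[of 0] have wrap: "s (n + n) = s 0"
    by (simp add: mult_2)
  have eq: "s k = s (k + n)" if "k < n" for k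
    using arcs[OF that] by (simp add: s_def y_def ac_simps)
  \<comment> \<open>The hypothesis covers starting positions below \<open>n\<close> only. At
    position \<open>n\<close> the two windows are those of position 0 with their roles
    exchanged.\<close>
  have "s (Suc i) = s (Suc i + n)"
  proof (cases "Suc i < n")
    case True
    then show ?thesis by (rule eq)
  next
    case False
    then have "Suc i = n"
      using i by simp
    then show ?thesis
      using eq[of 0] wrap i by simp
  qed
  moreover have "y (i + n + n) = y i"
    using period[of i] by (simp only: mult_2 add.assoc)
  ultimately have "y i = y (i + n)"
    using eq[OF i] shift[of i] shift[of "i + n"] by simp
  then show ?thesis
    using i by (simp add: y_def)
qed

lemma summand_opposite_edges:
  assumes P: "simplicial_poset P r" and sub: "subgraph P r G" and G: "bypassing P r G"
    and d': "is_metric P r d'" and d'': "is_metric P r d''"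
    and sum: "\<And>e. e \<in> edges P r \<Longrightarrow> graph_metric P r G e = d' e + d'' e"
    and opp: "(e, e') \<in> opposite_edges P r G"
  shows "e \<in> gedges G" and "e' \<in> gedges G" and "d' e = d' e'"
proof -
  obtain vs es n i where C: "isometric_even_cycle P r G n (vs, es)" and i: "i < n"
    and e: "e = es ! i" "e' = es ! (i + n)"
    using opp by (auto simp: opposite_edges_def)
  have len: "length es = 2 * n" and es: "set es \<subseteq> gedges G"
    using C by (auto simp: walk_in_def)
  then show "e \<in> gedges G" "e' \<in> gedges G"
    using e i by (auto intro!: subsetD[OF es])
  have "(\<Sum>j<n. d' (es ! ((k + j) mod (2 * n)))) = (\<Sum>j<n. d' (es ! ((k + n + j) mod (2 * n))))"
    if "k < n" for k
  proof -
    \<comment> \<open>\<open>f\<close> is the diagonal at position \<open>k\<close>. Both arcs are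
      shortest walks for it, so both \<open>d'\<close>-sums equal \<open>d' f\<close>.\<close>
    obtain f where f: "f \<in> edges P r" "arc (vs, es) k n \<in> shortest_walks P r G f"
      "arc (vs, es) (k + n) n \<in> shortest_walks P r G f"
      using C \<open>k < n\<close> unfolding isometric_even_cycle.simps by blast
    have arc_sum: "sum_list (map d' (snd (arc (vs, es) m n))) = (\<Sum>j<n. d' (es ! ((m + j) mod (2 * n))))"
      for m
      by (simp add: len comp_def interv_sum_list_conv_sum_set_nat atLeast0LessThan)
    have "sum_list (map d' (snd w)) = d' f" if "w \<in> shortest_walks P r G f" for w
      using summand_sum_shortest_walk[OF P sub G d' d'' _ f(1) that] sum by simp
    from this[OF f(2)] this[OF f(3)] show ?thesis
      unfolding arc_sum by simp
  qed
  from opposite_values_eq[of n "\<lambda>k. d' (es ! k)", OF this i] show "d' e = d' e'"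
    by (simp add: e)
qed

lemma ic_colorable_1_connected:
  assumes "ic_colorable P r 1 G"
  shows "gedges G \<noteq> {}" and "\<And>e e'. e \<in> gedges G \<Longrightarrow> e' \<in> gedges G \<Longrightarrow> (e, e') \<in> ic_equiv P r G"
proof -
  obtain C where C: "gedges G // ic_equiv P r G = {C}"
    using assms by (auto simp: ic_colorable_def card_1_singleton_iff)
  then show "gedges G \<noteq> {}"
    by auto
  fix e e' assume "e \<in> gedges G" "e' \<in> gedges G"
  then have "ic_equiv P r G `` {e} = ic_equiv P r G `` {e'}"
    using C quotientI by (metis singletonD)
  \<comment> \<open>Reflexivity puts \<open>e'\<close> into its own class, which is also the class
    of \<open>e\<close>.\<close>
  moreover have "(e', e') \<in> ic_equiv P r G"
    using \<open>e' \<in> gedges G\<close> by (auto simp: ic_equiv_def equiv_def refl_on_def)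
  ultimately show "(e, e') \<in> ic_equiv P r G"
    by blast
qed

theorem theorem4p9:
  fixes P :: "'a set" and r :: "'a rel" and G :: "'a graph"
  assumes "simplicial_poset P r" and "pure_2dim P r"
    and "subgraph P r G" and "bypassing P r G" and "ic_colorable P r 1 G"
  shows "extreme_metric P r (graph_metric P r G)"
proof -
  note P = assms(1) and sub = assms(3) and G = assms(4)
  obtain e0 where e0: "e0 \<in> gedges G"
    using ic_colorable_1_connected(1)[OF assms(5)] by blast
  have nonzero: "\<exists>e\<in>edges P r. graph_metric P r G e \<noteq> 0"
    using graph_metric_edge[OF P sub G e0] e0 sub by (intro bexI[of _ e0]) (auto simp: subgraph_def)
  have "\<exists>l\<ge>0. \<forall>e\<in>edges P r. d' e = l * graph_metric P r G e"
    if d': "is_metric P r d'" and d'': "is_metric P r d''"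
      and sum: "\<forall>e\<in>edges P r. graph_metric P r G e = d' e + d'' e" for d' d''
  proof (intro exI conjI ballI)
    have sum': "graph_metric P r G e = d' e + d'' e" if "e \<in> edges P r" for e
      using sum that by blast
    \<comment> \<open>Having equal \<open>d'\<close>-value is an equivalence on the edges of
      \<open>G\<close> that contains all opposite pairs, so by minimality it contains
      \<open>ic_equiv\<close>.\<close>
    let ?R = "{(e, e'). e \<in> gedges G \<and> e' \<in> gedges G \<and> d' e = d' e'}"
    have "(e, e') \<in> ?R" if "(e, e') \<in> opposite_edges P r G" for e e'
      using summand_opposite_edges[OF P sub G d' d'' _ that] sum' by simp
    then have "opposite_edges P r G \<subseteq> ?R"
      by (rule subrelI)
    moreover have "equiv (gedges G) ?R"
      by (rule equivI) (auto intro!: refl_onI symI transI)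
    ultimately have "ic_equiv P r G \<subseteq> ?R"
      unfolding ic_equiv_def by (intro Inter_lower) simp
    then have const: "d' e = d' e0" if "e \<in> gedges G" for e
      using ic_colorable_1_connected(2)[OF assms(5) that e0] by blast
    \<comment> \<open>This fixes the scalar left open by \<open>exI\<close>: the factor is the
      common value \<open>d' e0\<close> of \<open>d'\<close> on \<open>G\<close>.\<close>
    show "0 \<le> d' e0"
      using d' e0 sub by (auto simp: is_metric_def subgraph_def)
    fix e assume e: "e \<in> edges P r"
    obtain w where w: "w \<in> shortest_walks P r G e"
      using bypassing_shortest_walk[OF G e] .
    have "d' e = sum_list (map d' (snd w))"
      using summand_sum_shortest_walk[OF P sub G d' d'' _ e w] sum' by simp
    also have "map d' (snd w) = map (\<lambda>_. d' e0) (snd w)"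
      using w const by (intro map_cong) (auto simp: shortest_walks_def walk_in_def)
    also have "sum_list \<dots> = d' e0 * graph_metric P r G e"
      using graph_metric_shortest[OF w] by (simp add: sum_list_triv walk_length_def)
    finally show "d' e = d' e0 * graph_metric P r G e" .
  qed
  then show ?thesis
    using graph_metric_is_metric[OF P G] nonzero unfolding extreme_metric_def by blast
qed

end
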